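(* Let $\mathcal{X}=\{x_1,\dots,x_N\}$ be finite, let $L:\mathcal{X}\times\mathcal{A}\to\mathbb{R}$ be a bounded loss function, and let $\mathcal{P}$ be the set of all probability distributions on $\mathcal{X}$, identified with the unit simplex in $\mathbb{R}^N$ with its usual topology. Suppose that $\Gamma\subseteq\mathcal{P}$ is nonempty and convex, and that the risk-set $$S:=\{(L(x_1,\zeta),\dots,L(x_N,\zeta)):\zeta\in\mathcal{Z}\}\subseteq\mathbb{R}^N$$ is closed. Then there exists a robust Bayes act $\zeta^*\in\mathcal{Z}$ against $\Gamma$. Moreover, there exists $P^*$ in the closure $\overline{\Gamma}$ of $\Gamma$ such that $\zeta^*$ is Bayes against $P^*$ and $(P^*,\zeta^* )$ is a saddle-point in the game $\mathcal{G}^{\overline{\Gamma}}=(\overline{\Gamma},\mathcal{A},L)$.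
   Context: $\mathcal{A}$ is a (nonempty) measurable action space whose $\sigma$-field contains all singletons, and $L$ is jointly measurable. $\mathcal{Z}$ is the set of randomized acts (probability distributions on $\mathcal{A}$). For $\zeta\in\mathcal{Z}$ and $P\in\mathcal{P}$, $L(x,\zeta):=E_{A\sim\zeta}\{L(x,A)\}$ and $L(P,\zeta):=E_{(X,A)\sim P\times\zeta}\{L(X,A)\}$. An act $\zeta^*\in\mathcal{Z}$ is robust Bayes against $\Gamma$ if it attains $\inf_{\zeta\in\mathcal{Z}}\sup_{P\in\Gamma}L(P,\zeta)$. An act $\zeta_P\in\mathcal{Z}$ is Bayes against $P$ if $L(P,\zeta_P)\le L(P,\zeta)$ for all $\zeta\in\mathcal{Z}$. For a family $\Gamma'\subseteq\mathcal{P}$, a pair $(P^*,\zeta^* )\in\Gamma'\times\mathcal{Z}$ is a saddle-point in the game $\mathcal{G}^{\Gamma'}=(\Gamma',\mathcal{A},L)$ if $L(P^*,\zeta^* )$ is finite, $L(P^*,\zeta^* )\le L(P^*,\zeta)$ for all $\zeta\in\mathcal{Z}$ and $L(P^*,\zeta^* )\ge L(P,\zeta^* )$ for all $P\in\Gamma'$. *)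

theory Defs
  imports "HOL-Probability.Probability"
begin

text \<open>
  The finite sample space is a type \<open>'x\<close> of class finite with its discrete \<open>\<sigma>\<close>-field, and a
  distribution on it is an \<open>'x pmf\<close>. In the action space \<open>M\<close> only \<open>space M\<close> and \<open>sets M\<close> matter;
  a randomized act is a probability measure with the \<open>\<sigma>\<close>-field of \<open>M\<close>.
\<close>

abbreviation randomized_acts :: "'a measure \<Rightarrow> 'a measure set" where
  "randomized_acts M \<equiv> space (prob_algebra M)"

definition loss_at :: "('x \<Rightarrow> 'a \<Rightarrow> real) \<Rightarrow> 'x \<Rightarrow> 'a measure \<Rightarrow> real" where
  "loss_at L x \<zeta> = (\<integral>a. L x a \<partial>\<zeta>)"

definition expected_loss :: "('x \<Rightarrow> 'a \<Rightarrow> real) \<Rightarrow> 'x pmf \<Rightarrow> 'a measure \<Rightarrow> real" where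
  "expected_loss L P \<zeta> = (\<integral>(x, a). L x a \<partial>(measure_pmf P \<Otimes>\<^sub>M \<zeta>))"

definition bayes_act :: "'a measure \<Rightarrow> ('x \<Rightarrow> 'a \<Rightarrow> real) \<Rightarrow> 'x pmf \<Rightarrow> 'a measure \<Rightarrow> bool" where
  "bayes_act M L P \<zeta> \<longleftrightarrow> \<zeta> \<in> randomized_acts M \<and>
     (\<forall>\<zeta>'\<in>randomized_acts M. expected_loss L P \<zeta> \<le> expected_loss L P \<zeta>')"

text \<open>
  Suprema and infima are taken in the extended reals, so that they need no boundedness side
  conditions.
\<close>

definition robust_bayes_act ::
    "'a measure \<Rightarrow> ('x \<Rightarrow> 'a \<Rightarrow> real) \<Rightarrow> 'x pmf set \<Rightarrow> 'a measure \<Rightarrow> bool" where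
  "robust_bayes_act M L \<Gamma> \<zeta> \<longleftrightarrow> \<zeta> \<in> randomized_acts M \<and>
     (SUP P\<in>\<Gamma>. ereal (expected_loss L P \<zeta>)) =
     (INF \<zeta>'\<in>randomized_acts M. SUP P\<in>\<Gamma>. ereal (expected_loss L P \<zeta>'))"

text \<open>
  Finiteness of the value is integrability, as the Bochner integral of a non-integrable function
  is \<open>0\<close>.
\<close>

definition saddle_point ::
    "'x pmf set \<Rightarrow> 'a measure \<Rightarrow> ('x \<Rightarrow> 'a \<Rightarrow> real) \<Rightarrow> 'x pmf \<Rightarrow> 'a measure \<Rightarrow> bool" where
  "saddle_point \<Gamma> M L P \<zeta> \<longleftrightarrow> P \<in> \<Gamma> \<and> \<zeta> \<in> randomized_acts M \<and>
     integrable (measure_pmf P \<Otimes>\<^sub>M \<zeta>) (\<lambda>(x, a). L x a) \<and>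
     (\<forall>\<zeta>'\<in>randomized_acts M. expected_loss L P \<zeta> \<le> expected_loss L P \<zeta>') \<and>
     (\<forall>Q\<in>\<Gamma>. expected_loss L Q \<zeta> \<le> expected_loss L P \<zeta>)"

definition risk_set :: "'a measure \<Rightarrow> ('x::finite \<Rightarrow> 'a \<Rightarrow> real) \<Rightarrow> (real ^ 'x) set" where
  "risk_set M L = {(\<chi> x. loss_at L x \<zeta>) | \<zeta>. \<zeta> \<in> randomized_acts M}"

text \<open>
  The type \<open>pmf\<close> carries neither a convex structure nor a topology; both are those of the
  unit simplex, via the following identification.
\<close>

definition pmf_vec :: "'x::finite pmf \<Rightarrow> real ^ 'x" where
  "pmf_vec P = (\<chi> x. pmf P x)"

definition pmf_convex :: "'x::finite pmf set \<Rightarrow> bool" where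
  "pmf_convex \<Gamma> \<longleftrightarrow> convex (pmf_vec ` \<Gamma>)"

definition pmf_closure :: "'x::finite pmf set \<Rightarrow> 'x pmf set" where
  "pmf_closure \<Gamma> = {P. pmf_vec P \<in> closure (pmf_vec ` \<Gamma>)}"

lemma bij_betw_pmf_vec:
  "bij_betw pmf_vec UNIV {v :: real ^ 'x::finite. (\<forall>x. 0 \<le> v $ x) \<and> (\<Sum>x\<in>UNIV. v $ x) = 1}"
proof (rule bij_betw_imageI)
  show "inj (pmf_vec :: 'x pmf \<Rightarrow> _)"
    by (auto intro!: injI pmf_eqI simp: pmf_vec_def vec_eq_iff)
  show "range pmf_vec = {v :: real ^ 'x. (\<forall>x. 0 \<le> v $ x) \<and> (\<Sum>x\<in>UNIV. v $ x) = 1}"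
  proof (intro equalityI subsetI)
    fix v :: "real ^ 'x" assume "v \<in> range pmf_vec"
    then show "v \<in> {v. (\<forall>x. 0 \<le> v $ x) \<and> (\<Sum>x\<in>UNIV. v $ x) = 1}"
      by (auto simp: pmf_vec_def sum_pmf_eq_1)
  next
    fix v :: "real ^ 'x" assume v: "v \<in> {v. (\<forall>x. 0 \<le> v $ x) \<and> (\<Sum>x\<in>UNIV. v $ x) = 1}"
    then have "(\<integral>\<^sup>+x. ennreal (v $ x) \<partial>count_space UNIV) = 1"
      by (simp add: nn_integral_count_space_finite sum_ennreal)
    with v have "pmf (embed_pmf (\<lambda>x. v $ x)) x = v $ x" for x
      by (intro pmf_embed_pmf) auto
    then have "v = pmf_vec (embed_pmf (\<lambda>x. v $ x))"
      by (simp add: pmf_vec_def vec_eq_iff)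
    then show "v \<in> range pmf_vec" by blast
  qed
qed

end

theory Submission
  imports Defs
begin

text \<open>
  With \<open>K\<close> the closure of \<open>\<Gamma>\<close> in the simplex and \<open>S\<close> the risk set, the game is the bilinear game
  \<open>p \<bullet> s\<close> on compact convex sets. A saddle point of it is exactly a fixed point of
  \<open>(p, s) \<mapsto> (proj K (p + s), proj S (s - p))\<close>, by the variational characterization of the metric
  projection, so Brouwer's theorem provides one. By continuity, suprema over \<open>\<Gamma>\<close> and over its
  closure agree, so the \<open>s\<close>-component is robust Bayes against \<open>\<Gamma>\<close> itself.
\<close>

lemma bilinear_saddle_point:
  fixes K S :: "'v::euclidean_space set"
  assumes K: "compact K" "convex K" "K \<noteq> {}" and S: "compact S" "convex S" "S \<noteq> {}"
  obtains p s where "p \<in> K" "s \<in> S"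
    "\<And>q. q \<in> K \<Longrightarrow> q \<bullet> s \<le> p \<bullet> s" "\<And>t. t \<in> S \<Longrightarrow> p \<bullet> s \<le> p \<bullet> t"
proof -
  let ?f = "\<lambda>z. (closest_point K (fst z + snd z), closest_point S (snd z - fst z))"
  have closed: "closed K" "closed S"
    using K S by (auto intro: compact_imp_closed)
  have "continuous_on (K \<times> S) ?f"
    using K S closed
    by (intro continuous_on_Pair continuous_intros
        continuous_on_compose2[OF continuous_on_closest_point[of _ UNIV]]) auto
  moreover have "?f \<in> K \<times> S \<rightarrow> K \<times> S"
    using K S closed by (auto intro: closest_point_in_set)
  ultimately obtain z where z: "z \<in> K \<times> S" "?f z = z"
    using brouwer[of "K \<times> S" ?f] K S by (auto simp: compact_Times convex_Times)
  obtain p s where ps: "z = (p, s)" by force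
  with z have p: "closest_point K (p + s) = p" and s: "closest_point S (s - p) = s"
    by auto
  show thesis
  proof
    show "p \<in> K" "s \<in> S" using z ps by auto
    \<comment> \<open>The projection inequality at \<open>p + s\<close> reads
      \<open>(p + s - p) \<bullet> (q - p) \<le> 0\<close>, in which \<open>p\<close> cancels. At
      \<open>s - p\<close> below, \<open>s\<close> cancels likewise and leaves
      \<open>- p \<bullet> (t - s) \<le> 0\<close>.\<close>
    show "q \<bullet> s \<le> p \<bullet> s" if "q \<in> K" for q
      using closest_point_dot[OF K(2) closed(1) that, of "p + s"] p
      by (simp add: inner_diff_right inner_commute)
    show "p \<bullet> s \<le> p \<bullet> t" if "t \<in> S" for t
      using closest_point_dot[OF S(2) closed(2) that, of "s - p"] s
      by (simp add: inner_diff_right)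
  qed
qed

text \<open>The simplex is closed, so every limit of vectors from \<open>\<Gamma>\<close> is again
  the vector of a distribution. Points found in the closure can thus be pulled back to pmfs.\<close>

lemma pmf_vec_image_closure: "pmf_vec ` pmf_closure \<Gamma> = closure (pmf_vec ` \<Gamma>)"
proof -
  have "closed {v :: real ^ 'a::finite. (\<forall>x. 0 \<le> v $ x) \<and> (\<Sum>x\<in>UNIV. v $ x) = 1}"
    by (intro closed_Collect_conj closed_Collect_all closed_Collect_le closed_Collect_eq
        continuous_intros)
  then have "closed (range (pmf_vec :: 'a pmf \<Rightarrow> _))"
    by (simp only: bij_betw_imp_surj_on[OF bij_betw_pmf_vec])
  then have "closure (pmf_vec ` \<Gamma>) \<subseteq> range pmf_vec"
    by (intro closure_minimal) auto
  then show ?thesis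
    by (auto simp: pmf_closure_def)
qed

lemma bounded_range_pmf_vec: "bounded (range (pmf_vec :: 'x::finite pmf \<Rightarrow> _))"
proof (rule boundedI)
  fix v :: "real ^ 'x" assume "v \<in> range pmf_vec"
  then obtain P :: "'x pmf" where "v = pmf_vec P" by blast
  then show "norm v \<le> 1"
    using norm_le_l1_cart[of v] by (simp add: pmf_vec_def sum_pmf_eq_1)
qed

text \<open>Stated for an arbitrary space so that it serves both single acts on \<open>M\<close> and
  joint laws of state and action.\<close>

lemma integrable_bounded_measurable:
  fixes f :: "'a \<Rightarrow> real"
  assumes "f \<in> borel_measurable M" "bounded (f ` space M)" "\<zeta> \<in> randomized_acts M"
  shows "integrable \<zeta> f"
proof -
  have \<zeta>: "sets \<zeta> = sets M" "prob_space \<zeta>"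
    using assms(3) by (auto simp: space_prob_algebra)
  obtain B where "\<And>a. a \<in> space M \<Longrightarrow> norm (f a) \<le> B"
    using assms(2) by (auto simp: bounded_iff)
  then have "AE a in \<zeta>. norm (f a) \<le> B"
    using sets_eq_imp_space_eq[OF \<zeta>(1)] by (intro AE_I2) simp
  moreover have "f \<in> borel_measurable \<zeta>"
    using assms(1) by (subst measurable_cong_sets[OF \<zeta>(1) refl])
  ultimately show ?thesis
    using \<zeta>(2) by (intro finite_measure.integrable_const_bound prob_space.finite_measure)
qed

locale bounded_loss =
  fixes M :: "'a measure" and L :: "'x::finite \<Rightarrow> 'a \<Rightarrow> real"
  assumes nonempty: "space M \<noteq> {}"
    and measurable: "(\<lambda>(x, a). L x a) \<in> borel_measurable (count_space UNIV \<Otimes>\<^sub>M M)"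
    and bounded: "bounded ((\<lambda>(x, a). L x a) ` (UNIV \<times> space M))"
begin

lemma measurable_loss: "L x \<in> borel_measurable M"
proof -
  have "(\<lambda>a. (\<lambda>(x, a). L x a) (x, a)) \<in> borel_measurable M"
    by (rule measurable_compose[OF _ measurable]) simp
  then show ?thesis by simp
qed

lemma bounded_loss: "bounded (L x ` space M)"
  using bounded by (rule bounded_subset) auto

lemma integrable_product_loss:
  assumes "\<zeta> \<in> randomized_acts M"
  shows "integrable (measure_pmf P \<Otimes>\<^sub>M \<zeta>) (\<lambda>(x, a). L x a)"
proof -
  have \<zeta>: "sets \<zeta> = sets M" "prob_space \<zeta>"
    using assms by (auto simp: space_prob_algebra)
  interpret pair_prob_space "measure_pmf P" \<zeta>
    using \<zeta>(2) by (simp add: pair_prob_space_def pair_sigma_finite_def prob_space_measure_pmf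
        prob_space_imp_sigma_finite)
  have sets: "sets (measure_pmf P \<Otimes>\<^sub>M \<zeta>) = sets (count_space UNIV \<Otimes>\<^sub>M M)"
    by (intro sets_pair_measure_cong) (auto simp: \<zeta>)
  \<comment> \<open>The joint law is itself a probability measure on the product space, so the
    previous integrability result applies to it.\<close>
  have "(measure_pmf P \<Otimes>\<^sub>M \<zeta>) \<in> randomized_acts (count_space UNIV \<Otimes>\<^sub>M M)"
    using sets prob_space_axioms by (simp add: space_prob_algebra)
  then show ?thesis
    using measurable bounded
    by (intro integrable_bounded_measurable) (auto simp: space_pair_measure)
qed

text \<open>By Fubini the expectation becomes a finite sum over the states. This turns the game into
  the bilinear one: the distribution and the act enter only through two vectors.\<close>

lemma expected_loss_eq_inner:
  assumes "\<zeta> \<in> randomized_acts M"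
  shows "expected_loss L P \<zeta> = pmf_vec P \<bullet> (\<chi> x. loss_at L x \<zeta>)"
proof -
  have "prob_space \<zeta>"
    using assms by (auto simp: space_prob_algebra)
  then interpret pair_sigma_finite "measure_pmf P" \<zeta>
    by (simp add: pair_sigma_finite_def prob_space_measure_pmf prob_space_imp_sigma_finite)
  have "expected_loss L P \<zeta> = (\<integral>x. loss_at L x \<zeta> \<partial>measure_pmf P)"
    using integral_fst[OF integrable_product_loss[OF assms]]
    by (simp add: expected_loss_def loss_at_def)
  also have "\<dots> = (\<Sum>x\<in>UNIV. loss_at L x \<zeta> * pmf P x)"
    by (rule integral_measure_pmf_real) auto
  finally show ?thesis
    by (simp add: pmf_vec_def inner_vec_def mult.commute)
qed

lemma risk_set_nonempty: "risk_set M L \<noteq> {}"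
proof -
  obtain a where "a \<in> space M" using nonempty by blast
  then have "return M a \<in> randomized_acts M"
    by (simp add: space_prob_algebra prob_space_return)
  then show ?thesis by (auto simp: risk_set_def)
qed

text \<open>A bound on the loss bounds each coordinate of a risk vector, hence its l1 norm. Together
  with closedness this gives the compactness needed for the fixed point.\<close>

lemma bounded_risk_set: "bounded (risk_set M L)"
proof -
  obtain B where B: "\<And>x a. a \<in> space M \<Longrightarrow> norm (L x a) \<le> B"
    using bounded by (auto simp: bounded_iff)
  have "norm v \<le> (\<Sum>x\<in>(UNIV :: 'x set). B)" if v_in: "v \<in> risk_set M L" for v
  proof -
    obtain \<zeta> where \<zeta>: "\<zeta> \<in> randomized_acts M" and v: "v = (\<chi> x. loss_at L x \<zeta>)"
      using v_in by (auto simp: risk_set_def)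
    then interpret prob_space \<zeta> by (simp add: space_prob_algebra)
    have sp: "space \<zeta> = space M"
      using \<zeta> by (auto simp: space_prob_algebra dest: sets_eq_imp_space_eq)
    have "\<bar>loss_at L x \<zeta>\<bar> \<le> B" for x
    proof -
      have int: "integrable \<zeta> (L x)"
        by (rule integrable_bounded_measurable[OF measurable_loss bounded_loss \<zeta>])
      have "\<bar>loss_at L x \<zeta>\<bar> \<le> (\<integral>a. \<bar>L x a\<bar> \<partial>\<zeta>)"
        unfolding loss_at_def by (rule integral_abs_bound)
      also have "\<dots> \<le> (\<integral>a. B \<partial>\<zeta>)"
        using B int by (intro integral_mono) (auto simp: sp)
      finally show ?thesis by (simp add: prob_space)
    qed
    then have "(\<Sum>x\<in>UNIV. \<bar>v $ x\<bar>) \<le> (\<Sum>x\<in>(UNIV :: 'x set). B)"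
      by (intro sum_mono) (simp add: v)
    then show ?thesis
      using norm_le_l1_cart[of v] by linarith
  qed
  then show ?thesis by (rule boundedI)
qed

text \<open>The act realizing a convex combination tosses a coin with success probability
  \<open>r\<close> and then draws from \<open>\<zeta>\<close> or \<open>\<zeta>'\<close>
  accordingly; its losses average with weights \<open>r\<close> and
  \<open>1 - r = q\<close>.\<close>

lemma convex_risk_set: "convex (risk_set M L)"
proof (rule convexI)
  fix v w :: "real ^ 'x" and r q :: real
  assume v: "v \<in> risk_set M L" and w: "w \<in> risk_set M L" and rq: "0 \<le> r" "0 \<le> q" "r + q = 1"
  obtain \<zeta> \<zeta>' where \<zeta>: "\<zeta> \<in> randomized_acts M" "v = (\<chi> x. loss_at L x \<zeta>)"
    and \<zeta>': "\<zeta>' \<in> randomized_acts M" "w = (\<chi> x. loss_at L x \<zeta>')"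
    using v w by (auto simp: risk_set_def)
  let ?k = "\<lambda>b. if b then \<zeta> else \<zeta>'"
  let ?m = "measure_pmf (bernoulli_pmf r) \<bind> ?k"
  have k: "?k \<in> measure_pmf (bernoulli_pmf r) \<rightarrow>\<^sub>M prob_algebra M"
    using \<zeta>(1) \<zeta>'(1) by simp
  have coin: "measure_pmf (bernoulli_pmf r) \<in> space (prob_algebra (measure_pmf (bernoulli_pmf r)))"
    by (simp add: space_prob_algebra prob_space_measure_pmf)
  have m: "?m \<in> randomized_acts M"
    using prob_space_bind'[OF coin k] sets_bind'[OF coin k] by (simp add: space_prob_algebra)
  have "loss_at L x ?m = r * loss_at L x \<zeta> + q * loss_at L x \<zeta>'" for x
  proof -
    obtain B where B: "\<And>a. a \<in> space M \<Longrightarrow> norm (L x a) \<le> B"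
      using bounded_loss[of x] by (auto simp: bounded_iff)
    \<comment> \<open>Integration against the mixture is iterated; \<open>B\<close> bounds the loss,
      and \<open>B' = 1\<close> the total mass of each branch.\<close>
    have "loss_at L x ?m = (\<integral>b. (\<integral>a. L x a \<partial>?k b) \<partial>measure_pmf (bernoulli_pmf r))"
      unfolding loss_at_def using B sets_eq_imp_space_eq \<zeta>(1) \<zeta>'(1)
      by (intro integral_bind[OF measurable_loss, where B = B and B' = 1]
          measurable_prob_algebraD[OF k] measure_pmf.finite_measure_axioms)
        (auto simp: space_prob_algebra prob_space.emeasure_space_1)
    then show ?thesis
      using rq by (simp add: loss_at_def mult.commute eq_diff_eq)
  qed
  then have "r *\<^sub>R v + q *\<^sub>R w = (\<chi> x. loss_at L x ?m)"
    by (simp add: \<zeta>(2) \<zeta>'(2) vec_eq_iff)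
  with m show "r *\<^sub>R v + q *\<^sub>R w \<in> risk_set M L"
    by (auto simp: risk_set_def)
qed

text \<open>For a fixed act the expected loss is linear in the distribution, so its sublevel set at
  the supremum over \<open>\<Gamma>\<close> is closed and contains the closure along with
  \<open>\<Gamma>\<close>.\<close>

lemma SUP_expected_loss_closure:
  assumes "\<zeta> \<in> randomized_acts M"
  shows "(SUP P\<in>pmf_closure \<Gamma>. ereal (expected_loss L P \<zeta>)) =
    (SUP P\<in>\<Gamma>. ereal (expected_loss L P \<zeta>))"
proof (rule antisym)
  let ?c = "SUP P\<in>\<Gamma>. ereal (expected_loss L P \<zeta>)" and ?s = "\<chi> x. loss_at L x \<zeta>"
  have "closed {v. ereal (v \<bullet> ?s) \<le> ?c}"
    by (intro closed_Collect_le continuous_intros)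
  then have "closure (pmf_vec ` \<Gamma>) \<subseteq> {v. ereal (v \<bullet> ?s) \<le> ?c}"
    by (intro closure_minimal)
      (auto simp: expected_loss_eq_inner[OF assms] intro!: SUP_upper)
  then show "(SUP P\<in>pmf_closure \<Gamma>. ereal (expected_loss L P \<zeta>)) \<le> ?c"
    by (auto simp: expected_loss_eq_inner[OF assms] pmf_closure_def intro!: SUP_least)
  have "\<Gamma> \<subseteq> pmf_closure \<Gamma>"
    using closure_subset[of "pmf_vec ` \<Gamma>"] by (auto simp: pmf_closure_def)
  then show "?c \<le> (SUP P\<in>pmf_closure \<Gamma>. ereal (expected_loss L P \<zeta>))"
    by (rule SUP_subset_mono) simp
qed

lemma robust_bayes_act_if_saddle_point_closure:
  assumes "saddle_point (pmf_closure \<Gamma>) M L P \<zeta>"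
  shows "robust_bayes_act M L \<Gamma> \<zeta>"
  unfolding robust_bayes_act_def
proof (intro conjI antisym INF_greatest)
  have P: "P \<in> pmf_closure \<Gamma>" and \<zeta>: "\<zeta> \<in> randomized_acts M"
    and min: "\<And>\<zeta>'. \<zeta>' \<in> randomized_acts M \<Longrightarrow> expected_loss L P \<zeta> \<le> expected_loss L P \<zeta>'"
    and max: "\<And>Q. Q \<in> pmf_closure \<Gamma> \<Longrightarrow> expected_loss L Q \<zeta> \<le> expected_loss L P \<zeta>"
    using assms by (auto simp: saddle_point_def)
  show "\<zeta> \<in> randomized_acts M" by fact
  show "(INF \<zeta>'\<in>randomized_acts M. SUP P\<in>\<Gamma>. ereal (expected_loss L P \<zeta>'))
      \<le> (SUP P\<in>\<Gamma>. ereal (expected_loss L P \<zeta>))"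
    using \<zeta> by (rule INF_lower)
  fix \<zeta>' assume \<zeta>': "\<zeta>' \<in> randomized_acts M"
  \<comment> \<open>Both estimates pass through \<open>P\<close>: the maximum over the closure is
    attained there, and \<open>\<zeta>\<close> is optimal there. As \<open>P\<close> may lie outside
    \<open>\<Gamma>\<close>, the chain runs over the closure, and only its two ends are carried back
    to \<open>\<Gamma>\<close>.\<close>
  have "(SUP Q\<in>pmf_closure \<Gamma>. ereal (expected_loss L Q \<zeta>)) \<le> ereal (expected_loss L P \<zeta>')"
    using order_trans[OF max min[OF \<zeta>']] by (auto intro!: SUP_least)
  also have "\<dots> \<le> (SUP Q\<in>pmf_closure \<Gamma>. ereal (expected_loss L Q \<zeta>'))"
    using P by (rule SUP_upper)
  finally show "(SUP Q\<in>\<Gamma>. ereal (expected_loss L Q \<zeta>)) \<le> (SUP Q\<in>\<Gamma>. ereal (expected_loss L Q \<zeta>'))"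
    by (simp only: SUP_expected_loss_closure \<zeta> \<zeta>')
qed

end

theorem theorem5p2:
  fixes M :: "'a measure" and L :: "'x::finite \<Rightarrow> 'a \<Rightarrow> real" and \<Gamma> :: "'x pmf set"
  assumes "space M \<noteq> {}"
    and "\<And>a. a \<in> space M \<Longrightarrow> {a} \<in> sets M"
    and "(\<lambda>(x, a). L x a) \<in> borel_measurable (count_space UNIV \<Otimes>\<^sub>M M)"
    and "bounded ((\<lambda>(x, a). L x a) ` (UNIV \<times> space M))"
    and "\<Gamma> \<noteq> {}"
    and "pmf_convex \<Gamma>"
    and "closed (risk_set M L)"
  shows "\<exists>\<zeta>. robust_bayes_act M L \<Gamma> \<zeta> \<and>
           (\<exists>P\<in>pmf_closure \<Gamma>. bayes_act M L P \<zeta> \<and> saddle_point (pmf_closure \<Gamma>) M L P \<zeta>)"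
proof -
  interpret bounded_loss M L
    using assms(1,3,4) by unfold_locales
  have "compact (closure (pmf_vec ` \<Gamma>))"
    unfolding compact_closure by (rule bounded_subset[OF bounded_range_pmf_vec]) auto
  moreover have "convex (closure (pmf_vec ` \<Gamma>))"
    using assms(6) by (simp add: pmf_convex_def convex_closure)
  moreover have "compact (risk_set M L)"
    using assms(7) bounded_risk_set by (simp add: compact_eq_bounded_closed)
  ultimately obtain p s where p: "p \<in> closure (pmf_vec ` \<Gamma>)" and s: "s \<in> risk_set M L"
    and max: "\<And>q. q \<in> closure (pmf_vec ` \<Gamma>) \<Longrightarrow> q \<bullet> s \<le> p \<bullet> s"
    and min: "\<And>t. t \<in> risk_set M L \<Longrightarrow> p \<bullet> s \<le> p \<bullet> t"
    using bilinear_saddle_point[of "closure (pmf_vec ` \<Gamma>)" "risk_set M L"] convex_risk_set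
      risk_set_nonempty assms(5) by auto
  \<comment> \<open>The saddle point of vectors is translated back into a distribution
    \<open>P\<close> and an act \<open>\<zeta>\<close>.\<close>
  obtain P where P: "P \<in> pmf_closure \<Gamma>" "p = pmf_vec P"
    using p pmf_vec_image_closure by blast
  obtain \<zeta> where \<zeta>: "\<zeta> \<in> randomized_acts M" "s = (\<chi> x. loss_at L x \<zeta>)"
    using s by (auto simp: risk_set_def)
  \<comment> \<open>Minimality in the second component is at once the Bayes property of
    \<open>\<zeta>\<close> and one of the two saddle-point inequalities.\<close>
  have "expected_loss L P \<zeta> \<le> expected_loss L P \<zeta>'" if "\<zeta>' \<in> randomized_acts M" for \<zeta>'
    using min[of "\<chi> x. loss_at L x \<zeta>'"] that P(2) \<zeta>
    by (auto simp: expected_loss_eq_inner risk_set_def)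
  moreover have "expected_loss L Q \<zeta> \<le> expected_loss L P \<zeta>" if "Q \<in> pmf_closure \<Gamma>" for Q
    using max[of "pmf_vec Q"] that P(2) \<zeta> by (simp add: expected_loss_eq_inner pmf_closure_def)
  ultimately have "bayes_act M L P \<zeta>" "saddle_point (pmf_closure \<Gamma>) M L P \<zeta>"
    using P \<zeta> integrable_product_loss by (auto simp: bayes_act_def saddle_point_def)
  then show ?thesis
    using P(1) robust_bayes_act_if_saddle_point_closure by blast
qed

end
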